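(* Let $a,b$ be positive coprime integers with $a\ge b$, let $r$ be a positive integer and $b'=ra+b$. Let $D$ and $D'$ be the Euclidean designs of $a$ generated by $b$ and by $b'$, respectively. Then $D$ is a primitive design, $D'=0^rD$ (the word $D$ preceded by $r$ zeros), and the design numbers of $D$ and $D'$ are equal.
   Context: Designs: for $0\le m\le 2^n-1$, $\{m\}_n$ denotes the binary word $d_1\cdots d_n$ of length $n$ with $\sum 2^{n-i}d_i=m$; $m$ is its design number. $x^k$ denotes $k$ copies of the letter $x$. A design $\{m\}_n$ is primitive if $m$ is odd and $2^{n-1}\le m\le 2^n-1$ (i.e. the word is nonempty, begins with $1$ and ends with $1$). Partial quotients: for positive coprime $a,b$, the Euclidean algorithm $c_{i-2}=c_{i-1}r_i+c_i$ ($i=0,\dots,t-1$), $c_{-2}=a$, $c_{-1}=b$, $0\le c_i<c_{i-1}$, terminating with $c_{t-2}=1$, $c_{t-1}=0$, gives the partial quotients $r_0\ge 0, r_1,\dots,r_{t-1}\ge1$ of $a$ generated by $b$. Euclidean design of $a$ generated by $b$ (with $n=\sum r_i$): the word $1$ if $(a,b)=(1,1)$; $1^{r_0}0^{r_1}\cdots0^{r_{t-2}}1^{r_{t-1}}$ if $(a,b)\neq(1,1)$ and $t$ odd; $1^{r_0}0^{r_1}\cdots1^{r_{t-2}}0^{r_{t-1}-1}1$ if $(a,b)\ne(1,1)$ and $t$ even. *)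

theory Defs
  imports Main
begin

text \<open>
  Binary words are lists over the letters 0 and 1 (of type \<^typ>\<open>nat\<close>). The letter $d_i$ of a word
  \<open>w\<close>, with $1 \le i \le n$, is \<open>w ! (i - 1)\<close>.
\<close>

definition binary_word :: "nat list \<Rightarrow> bool" where
  "binary_word w \<longleftrightarrow> set w \<subseteq> {0, 1}"

definition design_number :: "nat list \<Rightarrow> nat" where
  "design_number w = (\<Sum>i = 1..length w. 2 ^ (length w - i) * w ! (i - 1))"

text \<open>\<open>is_design m n w\<close> says that \<open>w\<close> is the word $\{m\}_n$.\<close>

definition is_design :: "nat \<Rightarrow> nat \<Rightarrow> nat list \<Rightarrow> bool" where
  "is_design m n w \<longleftrightarrow> m \<le> 2 ^ n - 1 \<and> length w = n \<and> binary_word w \<and> design_number w = m"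

text \<open>
  For \<open>n = 0\<close> the bounds are contradictory, since \<open>2 ^ (0 - 1) = 1\<close> in \<^typ>\<open>nat\<close>; so the empty word
  is not primitive.
\<close>

definition primitive_design :: "nat list \<Rightarrow> bool" where
  "primitive_design w \<longleftrightarrow> (\<exists>m n. is_design m n w \<and> odd m \<and> 2 ^ (n - 1) \<le> m \<and> m \<le> 2 ^ n - 1)"

text \<open>
  The list $[r_0, \ldots, r_{t-1}]$; the arguments of the successive calls are the consecutive
  remainders $c_{i-2}, c_{i-1}$, and the recursion ends when $c_{t-1} = 0$.
\<close>

function partial_quotients :: "nat \<Rightarrow> nat \<Rightarrow> nat list" where
  "partial_quotients a b = (if b = 0 then [] else (a div b) # partial_quotients b (a mod b))"
  by pat_completeness auto
termination by (relation "measure snd") auto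

declare partial_quotients.simps [simp del]

text \<open>
  \<open>alternating_word r k\<close> is $1^{r_0} 0^{r_1} 1^{r_2} \cdots x^{r_{k-1}}$, built from the first \<open>k\<close>
  entries of \<open>r\<close>.
\<close>

definition alternating_word :: "nat list \<Rightarrow> nat \<Rightarrow> nat list" where
  "alternating_word r k = concat (map (\<lambda>i. replicate (r ! i) (if even i then 1 else 0)) [0..<k])"

definition euclidean_design :: "nat \<Rightarrow> nat \<Rightarrow> nat list" where
  "euclidean_design a b =
    (let r = partial_quotients a b; t = length r in
       if (a, b) = (1, 1) then [1]
       else if odd t then alternating_word r t
       else alternating_word r (t - 1) @ replicate (r ! (t - 1) - 1) 0 @ [1])"

end

theory Submission
  imports Defs
begin

text \<open>
  Since \<open>a\<close> is smaller than \<open>b' = r * a + b\<close>, the Euclidean algorithm on \<open>(a, b')\<close> first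
  produces the quotient 0. If \<open>b < a\<close>, it then produces \<open>r\<close> and continues with \<open>(a, b)\<close>, so two
  quotients are prepended, the parity of \<open>t\<close> is preserved, and the word gains the prefix $1^0 0^r$.
  If \<open>a = b\<close>, then both are 1 by coprimality, and the quotients \<open>[0, r + 1]\<close> give $0^r 1$.
  The word \<open>D\<close> is primitive because all quotients are positive when \<open>b \<le> a\<close>.
\<close>

lemma design_number_Nil [simp]: "design_number [] = 0"
  by (simp add: design_number_def)

text \<open>Turns the indexed sum into a recursion on the word, so that the later facts on design
  numbers follow by induction.\<close>

lemma design_number_Cons [simp]:
  "design_number (x # w) = 2 ^ length w * x + design_number w"
proof -
  have "design_number (x # w) =
      (\<Sum>i = Suc 0..Suc (length w). 2 ^ (Suc (length w) - i) * (x # w) ! (i - 1))"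
    by (simp add: design_number_def)
  also have "\<dots> = 2 ^ length w * x
      + (\<Sum>i = Suc (Suc 0)..Suc (length w). 2 ^ (Suc (length w) - i) * (x # w) ! (i - 1))"
    by (subst sum.atLeast_Suc_atMost) simp_all
  also have "(\<Sum>i = Suc (Suc 0)..Suc (length w). 2 ^ (Suc (length w) - i) * (x # w) ! (i - 1))
      = (\<Sum>i = Suc 0..length w. 2 ^ (length w - i) * (x # w) ! i)"
    by (subst sum.shift_bounds_cl_Suc_ivl) simp
  also have "\<dots> = design_number w"
    by (auto simp: design_number_def nth_Cons' intro!: sum.cong)
  finally show ?thesis .
qed

lemma design_number_snoc: "design_number (w @ [x]) = 2 * design_number w + x"
  by (induction w) simp_all

lemma design_number_replicate_0_append:
  "design_number (replicate k 0 @ w) = design_number w"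
  by (induction k) simp_all

lemma design_number_less:
  assumes "binary_word w"
  shows "design_number w < 2 ^ length w"
  using assms by (induction w) (auto simp: binary_word_def)

text \<open>The last letter decides the parity, and a leading 1 alone contributes
  \<open>2 ^ (length w - 1)\<close>.\<close>

lemma primitive_designI:
  assumes "binary_word w" and "w \<noteq> []" and "hd w = 1" and "last w = 1"
  shows "primitive_design w"
proof -
  have "w = butlast w @ [1]"
    using assms by (metis append_butlast_last_id)
  then have "odd (design_number w)"
    by (metis design_number_snoc even_add even_mult_iff dvd_refl odd_one)
  moreover have "2 ^ (length w - 1) \<le> design_number w"
    using assms by (cases w) auto
  ultimately show ?thesis
    using design_number_less[OF assms(1)] assms(1)
    by (auto simp: primitive_design_def is_design_def)
qed

lemma partial_quotients_eq_Nil_iff [simp]: "partial_quotients a b = [] \<longleftrightarrow> b = 0"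
  by (subst partial_quotients.simps) simp

text \<open>Only the first quotient could vanish, which \<open>b \<le> a\<close> excludes; the
  recursive call inherits the hypothesis because \<open>a mod b < b\<close>.\<close>

lemma partial_quotients_pos:
  assumes "b \<le> a"
  shows "\<forall>q \<in> set (partial_quotients a b). 0 < q"
  using assms
proof (induction a b rule: partial_quotients.induct)
  case (1 a b)
  show ?case
  proof (cases "b = 0")
    case False
    then have "a mod b \<le> b"
      by (simp add: less_imp_le)
    with 1 False show ?thesis
      by (subst partial_quotients.simps) (simp add: div_greater_zero_iff)
  qed (simp add: partial_quotients.simps)
qed

lemma partial_quotients_mult_add:
  assumes "0 < b" and "b < a" and "0 < r"
  shows "partial_quotients a (r * a + b) = 0 # r # partial_quotients a b"
proof -
  have "a \<le> r * a"
    using assms by simp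
  then have "a < r * a + b"
    using assms by linarith
  then have "partial_quotients a (r * a + b) = 0 # partial_quotients (r * a + b) a"
    using assms by (subst partial_quotients.simps) simp
  also have "partial_quotients (r * a + b) a = r # partial_quotients a b"
    using assms by (subst partial_quotients.simps) simp
  finally show ?thesis .
qed

lemma alternating_word_Suc:
  "alternating_word r (Suc k) = alternating_word r k @ replicate (r ! k) (if even k then 1 else 0)"
  by (simp add: alternating_word_def)

text \<open>Prepending two exponents shifts every index by 2, so each old block keeps its
  letter.\<close>

lemma alternating_word_Cons_Cons:
  "alternating_word (p # q # r) (Suc (Suc k))
    = replicate p 1 @ replicate q 0 @ alternating_word r k"
  by (induction k) (simp_all add: alternating_word_Suc, simp_all add: alternating_word_def)

lemma binary_word_alternating_word: "binary_word (alternating_word r k)"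
  by (auto simp: binary_word_def alternating_word_def split: if_splits)

lemma hd_alternating_word:
  assumes "0 < r ! 0" and "0 < k"
  shows "alternating_word r k \<noteq> [] \<and> hd (alternating_word r k) = 1"
proof -
  obtain j where "k = Suc j"
    using assms by (cases k) auto
  then show ?thesis
    using assms by (auto simp: alternating_word_def upt_conv_Cons simp del: upt_Suc)
qed

lemma primitive_euclidean_design:
  assumes "0 < b" and "b \<le> a"
  shows "primitive_design (euclidean_design a b)"
proof -
  define q where "q = partial_quotients a b"
  define t where "t = length q"
  have "0 < t"
    using assms by (simp add: q_def t_def)
  have pos: "0 < q ! i" if "i < t" for i
    using partial_quotients_pos[OF assms(2)] that by (simp add: q_def t_def)
  note head = hd_alternating_word[OF pos[OF \<open>0 < t\<close>]]
  have design: "euclidean_design a b = (if (a, b) = (1, 1) then [1]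
      else if odd t then alternating_word q t
      else alternating_word q (t - 1) @ replicate (q ! (t - 1) - 1) 0 @ [1])"
    by (simp add: euclidean_design_def Let_def q_def t_def)
  consider "(a, b) = (1, 1)" | "(a, b) \<noteq> (1, 1)" "odd t" | "(a, b) \<noteq> (1, 1)" "even t"
    by blast
  then show ?thesis
  proof cases
    case 1
    then show ?thesis
      by (auto simp: euclidean_design_def binary_word_def intro!: primitive_designI)
  next
    case 2
    \<comment> \<open>The last block has the even index \<open>k\<close>, so it consists of ones,
      and it is nonempty since its quotient is positive.\<close>
    then obtain k where k: "t = Suc k" "even k"
      by (cases t) auto
    have "last (alternating_word q t) = 1"
      using pos[of k] k by (simp add: alternating_word_Suc)
    then have "primitive_design (alternating_word q t)"
      using head[OF \<open>0 < t\<close>] binary_word_alternating_word by (intro primitive_designI) auto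
    with 2 design show ?thesis
      by auto
  next
    case 3
    \<comment> \<open>An even positive \<open>t\<close> is at least 2, so the alternating part still
      contains the leading block of ones; the final 1 is explicit.\<close>
    then have "0 < t - 1"
      using \<open>0 < t\<close> by (cases "t = 1") auto
    have "primitive_design (alternating_word q (t - 1) @ replicate (q ! (t - 1) - 1) 0 @ [1])"
      using head[OF \<open>0 < t - 1\<close>] binary_word_alternating_word[of q "t - 1"]
      by (intro primitive_designI) (auto simp: binary_word_def)
    with 3 design show ?thesis
      by auto
  qed
qed

lemma euclidean_design_mult_add:
  assumes "0 < b" and "b < a" and "0 < r"
  shows "euclidean_design a (r * a + b) = replicate r 0 @ euclidean_design a b"
proof -
  define q where "q = partial_quotients a b"
  \<comment> \<open>With \<open>q\<close> nonempty, \<open>t - 1\<close> is not truncated, and the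
    last index moves from \<open>k\<close> to \<open>Suc (Suc k)\<close>.\<close>
  obtain k where k: "length q = Suc k"
    using assms by (cases q) (auto simp: q_def)
  have "alternating_word (0 # r # q) (Suc (Suc j)) = replicate r 0 @ alternating_word q j" for j
    by (simp add: alternating_word_Cons_Cons)
  then show ?thesis
    using assms k partial_quotients_mult_add[OF assms]
    by (simp add: euclidean_design_def Let_def flip: q_def)
qed

text \<open>Here \<open>t = 2\<close> is even, so the last quotient \<open>r + 1\<close> is lowered
  to \<open>r\<close> zeros before the final 1; \<open>r > 0\<close> keeps the pair away from
  \<open>(1, 1)\<close>.\<close>

lemma euclidean_design_1_Suc:
  assumes "0 < r"
  shows "euclidean_design 1 (Suc r) = replicate r 0 @ [1]"
proof -
  have "partial_quotients 1 (Suc r) = [0, Suc r]"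
    using assms by (simp add: partial_quotients.simps)
  then show ?thesis
    using assms by (simp add: euclidean_design_def alternating_word_def)
qed

theorem theorem3p9:
  fixes a b r :: nat
  assumes "a > 0" and "b > 0" and "coprime a b" and "a \<ge> b" and "r > 0"
  shows "primitive_design (euclidean_design a b)
    \<and> euclidean_design a (r * a + b) = replicate r 0 @ euclidean_design a b
    \<and> design_number (euclidean_design a (r * a + b)) = design_number (euclidean_design a b)"
proof -
  have "euclidean_design a (r * a + b) = replicate r 0 @ euclidean_design a b"
  proof (cases "a = b")
    case True
    then have "a = 1" "b = 1"
      using assms by auto
    then show ?thesis
      using euclidean_design_1_Suc[OF \<open>r > 0\<close>] by (simp add: euclidean_design_def)
  next
    case False
    with assms show ?thesis
      by (simp add: euclidean_design_mult_add)
  qed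
  with assms show ?thesis
    by (simp add: primitive_euclidean_design design_number_replicate_0_append)
qed

end
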